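(* Let $(X,d)$ be a $1$-bounded pseudometric space. Then for all $\mu,\nu\in\mathcal{D}X$, \[ d_{LP}(d)(\mu,\nu)=K_\lambda(d)(\mu,\nu)=W_\lambda(d)(\mu,\nu). \]
   Context: A $1$-bounded pseudometric on $X$ is $d\colon X\times X\to[0,1]$ that is reflexive, symmetric and satisfies the triangle inequality. $\mathcal{D}X$ is the set of finitely supported probability distributions on $X$, with $\mu(A)=\sum_{x\in A}\mu(x)$. The Lévy–Prokhorov distance is $d_{LP}(d)(\mu,\nu)=\inf\{\epsilon\mid\forall A\subseteq X.\ \mu(A)\le\nu(A^d_\epsilon)+\epsilon\}$, where $A^d_\epsilon=\{y\in X\mid\inf_{x\in A}d(x,y)\le\epsilon\}$. The predicate lifting $\lambda$ is $\lambda_Z(f)(\mu)=\inf\{\epsilon\ge0\mid\mu(\{z\mid f(z)>\epsilon\})\le\epsilon\}$ for $f\colon Z\to[0,1]$. The Kantorovich lifting is $K_\lambda(d)(\mu,\nu)=\sup\{|\lambda_X(f)(\nu)-\lambda_X(f)(\mu)|\mid f\colon(X,d)\to([0,1],|\cdot-\cdot|)\text{ nonexpansive}\}$. The Wasserstein lifting is $W_\lambda(d)(\mu,\nu)=\inf\{\lambda_{X\times X}(d)(\rho)\mid\rho\in\mathcal{D}(X\times X)\text{ with marginals }\mu,\nu\}$. *)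

theory Defs
  imports "HOL-Probability.Probability_Mass_Function"
begin

text \<open>The underlying set \<open>X\<close> is the type \<^typ>\<open>'a\<close>. Nothing is lost by this: there is no
  probability distribution on the empty set.\<close>

definition bounded_pseudometric :: "('a \<Rightarrow> 'a \<Rightarrow> real) \<Rightarrow> bool" where
  "bounded_pseudometric d \<longleftrightarrow>
     (\<forall>x y. d x y \<in> {0..1}) \<and>
     (\<forall>x. d x x = 0) \<and>
     (\<forall>x y. d x y = d y x) \<and>
     (\<forall>x y z. d x z \<le> d x y + d y z)"

definition fin_dists :: "'a pmf set" where
  "fin_dists = {\<mu>. finite (set_pmf \<mu>)}"

text \<open>The infimum over \<open>x \<in> A\<close> of \<open>d x y\<close> is taken in the complete lattice \<open>[0,1]\<close>, so that it is
  \<open>1\<close> for empty \<open>A\<close>, whereas \<^term>\<open>Inf {} :: real\<close> is unspecified. Inserting \<open>1\<close> does not change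
  the infimum for nonempty \<open>A\<close>, as \<open>d\<close> is bounded by \<open>1\<close>.\<close>

definition set_dist :: "('a \<Rightarrow> 'a \<Rightarrow> real) \<Rightarrow> 'a set \<Rightarrow> 'a \<Rightarrow> real" where
  "set_dist d A y = Inf (insert 1 ((\<lambda>x. d x y) ` A))"

lemma set_dist_empty: "set_dist d {} y = 1"
  by (simp add: set_dist_def)

lemma set_dist_nonempty:
  assumes "bounded_pseudometric d" and "A \<noteq> {}"
  shows "set_dist d A y = (INF x\<in>A. d x y)"
proof -
  have bdd: "bdd_below ((\<lambda>x. d x y) ` A)"
    using assms(1) by (intro bdd_belowI2[of _ 0]) (auto simp: bounded_pseudometric_def)
  obtain a where a: "a \<in> A" using assms(2) by blast
  have "(INF x\<in>A. d x y) \<le> d a y" by (rule cINF_lower[OF bdd a])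
  also have "d a y \<le> 1" using assms(1) by (auto simp: bounded_pseudometric_def)
  finally show ?thesis
    unfolding set_dist_def using assms(2) bdd
    by (simp add: cInf_insert inf_absorb2)
qed

definition fattening :: "('a \<Rightarrow> 'a \<Rightarrow> real) \<Rightarrow> real \<Rightarrow> 'a set \<Rightarrow> 'a set" where
  "fattening d \<epsilon> A = {y. set_dist d A y \<le> \<epsilon>}"

text \<open>Negative \<open>\<epsilon>\<close> are excluded by the instance \<open>A = {}\<close>.\<close>

definition levy_prokhorov :: "('a \<Rightarrow> 'a \<Rightarrow> real) \<Rightarrow> 'a pmf \<Rightarrow> 'a pmf \<Rightarrow> real" where
  "levy_prokhorov d \<mu> \<nu> =
     Inf {\<epsilon>. \<forall>A. measure_pmf.prob \<mu> A \<le> measure_pmf.prob \<nu> (fattening d \<epsilon> A) + \<epsilon>}"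

definition prob_lifting :: "('z \<Rightarrow> real) \<Rightarrow> 'z pmf \<Rightarrow> real" where
  "prob_lifting f \<mu> = Inf {\<epsilon>. 0 \<le> \<epsilon> \<and> measure_pmf.prob \<mu> {z. f z > \<epsilon>} \<le> \<epsilon>}"

definition nonexpansive :: "('a \<Rightarrow> 'a \<Rightarrow> real) \<Rightarrow> ('a \<Rightarrow> real) \<Rightarrow> bool" where
  "nonexpansive d f \<longleftrightarrow> (\<forall>x. f x \<in> {0..1}) \<and> (\<forall>x y. \<bar>f x - f y\<bar> \<le> d x y)"

text \<open>The parameter \<open>L\<close> is the component of the predicate lifting at \<open>X\<close> for \<open>kantorovich\<close>, and
  at \<open>X \<times> X\<close> for \<open>wasserstein\<close>.\<close>

definition kantorovich ::
  "(('a \<Rightarrow> real) \<Rightarrow> 'a pmf \<Rightarrow> real) \<Rightarrow> ('a \<Rightarrow> 'a \<Rightarrow> real) \<Rightarrow> 'a pmf \<Rightarrow> 'a pmf \<Rightarrow> real" where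
  "kantorovich L d \<mu> \<nu> = Sup {\<bar>L f \<nu> - L f \<mu>\<bar> | f. nonexpansive d f}"

definition couplings :: "'a pmf \<Rightarrow> 'a pmf \<Rightarrow> ('a \<times> 'a) pmf set" where
  "couplings \<mu> \<nu> = {\<rho> \<in> fin_dists. map_pmf fst \<rho> = \<mu> \<and> map_pmf snd \<rho> = \<nu>}"

definition wasserstein ::
  "(('a \<times> 'a \<Rightarrow> real) \<Rightarrow> ('a \<times> 'a) pmf \<Rightarrow> real) \<Rightarrow> ('a \<Rightarrow> 'a \<Rightarrow> real) \<Rightarrow> 'a pmf \<Rightarrow> 'a pmf \<Rightarrow> real" where
  "wasserstein L d \<mu> \<nu> = (INF \<rho>\<in>couplings \<mu> \<nu>. L (case_prod d) \<rho>)"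

end

theory Submission
  imports Defs
begin

text \<open>The three distances are compared in a cycle. \<open>W \<le> d\<^sub>L\<^sub>P\<close> is Strassen's theorem: the
  Levy-Prokhorov condition is a fractional Hall condition with deficiency \<open>\<epsilon>\<close>, so all but mass
  \<open>\<epsilon>\<close> of \<open>\<mu>\<close> can be transported to \<open>\<nu>\<close> along pairs at distance at most \<open>\<epsilon>\<close>. \<open>K \<le> W\<close> holds because
  for a coupling that puts mass at most \<open>\<epsilon>\<close> on \<open>d > \<epsilon>\<close>, a nonexpansive \<open>f\<close> can exceed \<open>\<delta> + \<epsilon>\<close> on
  the one side only if it exceeds \<open>\<delta>\<close> on the other or \<open>d > \<epsilon>\<close>. Finally, a set \<open>A\<close> with
  \<open>\<mu>(A) > \<nu>(A\<^sub>\<epsilon>) + \<epsilon>\<close> yields the witness \<open>f(y) = max 0 (\<mu>(A) - d(A, y))\<close> for \<open>K \<ge> \<epsilon>\<close>.\<close>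

section \<open>The fractional Hall theorem\<close>

text \<open>Sources are emptied exactly, sinks only filled up to capacity. A plan is a total
  function that vanishes off \<open>X\<close> times \<open>Y\<close>, so plans for disjoint
  subproblems can be added pointwise.\<close>

definition transport ::
  "('a \<times> 'b) set \<Rightarrow> 'a set \<Rightarrow> 'b set \<Rightarrow> ('a \<Rightarrow> real) \<Rightarrow> ('b \<Rightarrow> real) \<Rightarrow> ('a \<Rightarrow> 'b \<Rightarrow> real) \<Rightarrow> bool"
where
  "transport R X Y a b g \<longleftrightarrow>
     (\<forall>x y. 0 \<le> g x y) \<and>
     (\<forall>x y. g x y \<noteq> 0 \<longrightarrow> x \<in> X \<and> y \<in> Y \<and> (x, y) \<in> R) \<and>
     (\<forall>x\<in>X. (\<Sum>y\<in>Y. g x y) = a x) \<and>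
     (\<forall>y\<in>Y. (\<Sum>x\<in>X. g x y) \<le> b y)"

text \<open>Intersecting with \<open>Y\<close> keeps the sums finite and lets \<open>R\<close> stay
  fixed while \<open>X\<close> and \<open>Y\<close> shrink in the induction.\<close>

definition hall ::
  "('a \<times> 'b) set \<Rightarrow> 'a set \<Rightarrow> 'b set \<Rightarrow> ('a \<Rightarrow> real) \<Rightarrow> ('b \<Rightarrow> real) \<Rightarrow> bool"
where
  "hall R X Y a b \<longleftrightarrow>
     (\<forall>x\<in>X. 0 \<le> a x) \<and> (\<forall>y\<in>Y. 0 \<le> b y) \<and> (\<forall>A\<subseteq>X. sum a A \<le> sum b (Y \<inter> R `` A))"

section \<open>Assembling transport plans from smaller ones\<close>

lemma transport_zero_outside:
  assumes "transport R X Y a b g" "x \<notin> X \<or> y \<notin> Y"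
  shows "g x y = 0"
  using assms unfolding transport_def by blast

lemma transport_push:
  assumes fin: "finite X" "finite Y" and xy: "x0 \<in> X" "y0 \<in> Y" "(x0, y0) \<in> R" and t: "0 \<le> t"
    and g: "transport R X Y (a(x0 := a x0 - t)) (b(y0 := b y0 - t)) g"
  shows "transport R X Y a b (\<lambda>x y. g x y + (if x = x0 \<and> y = y0 then t else 0))"
proof -
  have row: "(\<Sum>y\<in>Y. if x = x0 \<and> y = y0 then t else 0) = (if x = x0 then t else 0)" for x
    using fin(2) xy(2) by (cases "x = x0") auto
  have col: "(\<Sum>x\<in>X. if x = x0 \<and> y = y0 then t else 0) = (if y = y0 then t else 0)" for y
    using fin(1) xy(1) by (cases "y = y0") auto
  have rg: "(\<Sum>y\<in>Y. g x y) = (if x = x0 then a x0 - t else a x)" if "x \<in> X" for x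
    using g that by (auto simp: transport_def)
  have cg: "(\<Sum>x\<in>X. g x y) \<le> (if y = y0 then b y0 - t else b y)" if "y \<in> Y" for y
    using g that by (auto simp: transport_def)
  have "(\<Sum>y\<in>Y. g x y + (if x = x0 \<and> y = y0 then t else 0)) = a x" if "x \<in> X" for x
    using rg[OF that] by (simp add: sum.distrib row)
  moreover have "(\<Sum>x\<in>X. g x y + (if x = x0 \<and> y = y0 then t else 0)) \<le> b y" if "y \<in> Y" for y
    using cg[OF that] by (simp add: sum.distrib col split: if_splits)
  moreover have "0 \<le> g x y" "g x y \<noteq> 0 \<Longrightarrow> x \<in> X \<and> y \<in> Y \<and> (x, y) \<in> R" for x y
    using g unfolding transport_def by auto
  ultimately show ?thesis using t xy unfolding transport_def by (auto split: if_splits)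
qed

lemma transport_insert_source:
  assumes "finite X" "transport R (X - {x0}) Y a b g" "a x0 = 0"
  shows "transport R X Y a b g"
proof -
  have "(\<Sum>x\<in>X. g x y) = (\<Sum>x\<in>X - {x0}. g x y)" for y
    using assms(1) transport_zero_outside[OF assms(2)] by (intro sum.mono_neutral_right) auto
  moreover have "(\<Sum>y\<in>Y. g x0 y) = 0"
    using transport_zero_outside[OF assms(2)] by simp
  ultimately show ?thesis
    using assms(2,3) unfolding transport_def by (metis DiffI DiffD1 singletonD)
qed

lemma transport_insert_sink:
  assumes "finite Y" "transport R X (Y - {y0}) a b g" "0 \<le> b y0"
  shows "transport R X Y a b g"
proof -
  have "(\<Sum>y\<in>Y. g x y) = (\<Sum>y\<in>Y - {y0}. g x y)" for x
    using assms(1) transport_zero_outside[OF assms(2)] by (intro sum.mono_neutral_right) auto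
  moreover have "(\<Sum>x\<in>X. g x y0) = 0"
    using transport_zero_outside[OF assms(2)] by simp
  ultimately show ?thesis
    using assms(2,3) unfolding transport_def by (metis DiffI DiffD1 singletonD)
qed

text \<open>The supports of \<open>g\<close> and \<open>h\<close> share no row and no column, so
  each row or column sum comes from just one of the two plans.\<close>

lemma transport_union:
  assumes fin: "finite X" "finite Y" and sub: "A \<subseteq> X" "B \<subseteq> Y"
    and g: "transport R A B a b g" and h: "transport R (X - A) (Y - B) a b h"
  shows "transport R X Y a b (\<lambda>x y. g x y + h x y)"
proof -
  have g0: "g x y = 0" if "x \<notin> A \<or> y \<notin> B" for x y
    using transport_zero_outside[OF g that] .
  have h0: "h x y = 0" if "x \<in> A \<or> y \<in> B" for x y
    using transport_zero_outside[OF h] that by auto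
  have "(\<Sum>y\<in>Y. g x y + h x y) = a x" if "x \<in> X" for x
  proof (cases "x \<in> A")
    case True
    have "(\<Sum>y\<in>Y. g x y + h x y) = (\<Sum>y\<in>B. g x y)"
      using fin sub True g0 h0 by (intro sum.mono_neutral_cong_right) auto
    then show ?thesis using g True by (auto simp: transport_def)
  next
    case False
    have "(\<Sum>y\<in>Y. g x y + h x y) = (\<Sum>y\<in>Y - B. h x y)"
      using fin sub False g0 h0 by (intro sum.mono_neutral_cong_right) auto
    then show ?thesis using h False that by (auto simp: transport_def)
  qed
  moreover have "(\<Sum>x\<in>X. g x y + h x y) \<le> b y" if "y \<in> Y" for y
  proof (cases "y \<in> B")
    case True
    have "(\<Sum>x\<in>X. g x y + h x y) = (\<Sum>x\<in>A. g x y)"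
      using fin sub True g0 h0 by (intro sum.mono_neutral_cong_right) auto
    then show ?thesis using g True by (auto simp: transport_def)
  next
    case False
    have "(\<Sum>x\<in>X. g x y + h x y) = (\<Sum>x\<in>X - A. h x y)"
      using fin sub False g0 h0 by (intro sum.mono_neutral_cong_right) auto
    then show ?thesis using h False that by (auto simp: transport_def)
  qed
  moreover have "0 \<le> g x y + h x y" for x y
    using g h unfolding transport_def by simp
  moreover have "x \<in> X \<and> y \<in> Y \<and> (x, y) \<in> R" if "g x y + h x y \<noteq> 0" for x y
  proof -
    have "g x y \<noteq> 0 \<or> h x y \<noteq> 0" using that by auto
    then show ?thesis using g h sub unfolding transport_def by blast
  qed
  ultimately show ?thesis unfolding transport_def by blast
qed

section \<open>Preservation of the Hall condition\<close>

lemma hall_diff_sink: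
  assumes "finite Y" "hall R X Y a b" "b y0 = 0"
  shows "hall R X (Y - {y0}) a b"
proof -
  have "sum b (Y \<inter> R `` A) = sum b ((Y - {y0}) \<inter> R `` A)" for A
    using assms(1,3) by (intro sum.mono_neutral_right) auto
  then show ?thesis using assms(2) unfolding hall_def by auto
qed

text \<open>For \<open>B\<close> disjoint from \<open>A\<close>, subtract the equality for
  \<open>A\<close> from the Hall inequality for the union of \<open>A\<close> and \<open>B\<close>;
  the remainder concerns only neighbours of \<open>B\<close> that are not neighbours of
  \<open>A\<close>.\<close>

lemma hall_diff_tight:
  assumes fin: "finite X" "finite Y" and hall: "hall R X Y a b"
    and A: "A \<subseteq> X" "sum a A = sum b (Y \<inter> R `` A)"
  shows "hall R (X - A) (Y - Y \<inter> R `` A) a b"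
proof -
  have "sum a B \<le> sum b ((Y - Y \<inter> R `` A) \<inter> R `` B)" if B: "B \<subseteq> X - A" for B
  proof -
    have "sum a A + sum a B = sum a (A \<union> B)"
      using fin A B by (subst sum.union_disjoint) (auto dest: finite_subset)
    also have "\<dots> \<le> sum b (Y \<inter> R `` (A \<union> B))"
    proof -
      have "A \<union> B \<subseteq> X" using A B by auto
      then show ?thesis using hall unfolding hall_def by blast
    qed
    also have "Y \<inter> R `` (A \<union> B) = (Y \<inter> R `` A) \<union> ((Y - Y \<inter> R `` A) \<inter> R `` B)" by auto
    also have "sum b \<dots> = sum b (Y \<inter> R `` A) + sum b ((Y - Y \<inter> R `` A) \<inter> R `` B)"
      using fin by (intro sum.union_disjoint) auto
    finally show ?thesis using A by simp
  qed
  then show ?thesis using hall unfolding hall_def by auto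
qed

text \<open>A set containing \<open>x0\<close> also reaches \<open>y0\<close>, so both sides lose
  \<open>t\<close>. Only sets that reach \<open>y0\<close> without containing \<open>x0\<close> lose
  \<open>t\<close> on the right alone, and \<open>slack\<close> covers these.\<close>

lemma hall_push:
  assumes fin: "finite X" "finite Y" and hall: "hall R X Y a b"
    and xy: "x0 \<in> X" "y0 \<in> Y" "(x0, y0) \<in> R"
    and t: "t \<le> a x0" "t \<le> b y0"
    and slack: "\<And>A. A \<subseteq> X - {x0} \<Longrightarrow> y0 \<in> R `` A \<Longrightarrow> t \<le> sum b (Y \<inter> R `` A) - sum a A"
  shows "hall R X Y (a(x0 := a x0 - t)) (b(y0 := b y0 - t))"
proof -
  have sum_upd: "sum (f(z := f z - t)) S = sum f S - (if z \<in> S then t else 0)" if "finite S"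
    for f :: "'z \<Rightarrow> real" and z S
    using that by (induction S) auto
  have "sum (a(x0 := a x0 - t)) A \<le> sum (b(y0 := b y0 - t)) (Y \<inter> R `` A)" if A: "A \<subseteq> X" for A
  proof -
    have "sum a A \<le> sum b (Y \<inter> R `` A)" using hall A unfolding hall_def by blast
    moreover have "x0 \<in> A \<Longrightarrow> y0 \<in> Y \<inter> R `` A" using xy by auto
    moreover have "t \<le> sum b (Y \<inter> R `` A) - sum a A" if "x0 \<notin> A" "y0 \<in> Y \<inter> R `` A"
      using slack[of A] that A by auto
    moreover have "finite A" "finite (Y \<inter> R `` A)" using fin A finite_subset by auto
    ultimately show ?thesis by (smt (verit) sum_upd)
  qed
  then show ?thesis using hall t unfolding hall_def by auto
qed

text \<open>A version of the Halmos-Vaughan argument for real weights. The weights are generalised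
  in the induction because shipping mass changes them.\<close>

theorem fractional_hall:
  assumes "finite X" "finite Y" "hall R X Y a b"
  shows "\<exists>g. transport R X Y a b g"
  using assms
proof (induction "card X + card Y" arbitrary: X Y a b rule: less_induct)
  case less
  note fin = \<open>finite X\<close> \<open>finite Y\<close> and hall = \<open>hall R X Y a b\<close>
  show ?case
  proof (cases "X = {}")
    case True
    then have "transport R X Y a b (\<lambda>_ _. 0)" using hall unfolding transport_def hall_def by auto
    then show ?thesis by blast
  next
    case False
    then obtain x0 where x0: "x0 \<in> X" by auto
    have drop_source: "\<exists>g. transport R X Y a' b' g" if "hall R X Y a' b'" "a' x0 = 0" for a' b'
    proof -
      have "card (X - {x0}) < card X" using x0 fin by (intro psubset_card_mono) auto
      moreover have "hall R (X - {x0}) Y a' b'" using that(1) unfolding hall_def by auto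
      ultimately obtain g where "transport R (X - {x0}) Y a' b' g"
        using less.hyps[of "X - {x0}" Y] fin by auto
      then show ?thesis using transport_insert_source[of X R x0 Y a' b' g] fin that(2) by blast
    qed
    show ?thesis
    proof (cases "a x0 = 0")
      case True
      then show ?thesis using drop_source hall by blast
    next
      case False
      have "0 < a x0" using False hall x0 unfolding hall_def by fastforce
      also have "a x0 \<le> sum b (Y \<inter> R `` {x0})"
        using hall x0 unfolding hall_def by (auto dest: spec[of _ "{x0}"])
      finally have "Y \<inter> R `` {x0} \<noteq> {}" by (metis less_irrefl sum.empty)
      then obtain y0 where y0: "y0 \<in> Y" "(x0, y0) \<in> R" by auto
      \<comment> \<open>Ship the largest amount \<open>t\<close> from \<open>x0\<close> to \<open>y0\<close> that preserves the Hall condition. Then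
        \<open>x0\<close> or \<open>y0\<close> is exhausted, or a tight set \<open>A\<close> splits the problem.\<close>
      define T where "T = {A. A \<subseteq> X - {x0} \<and> y0 \<in> R `` A}"
      define slack where "slack A = sum b (Y \<inter> R `` A) - sum a A" for A
      define C where "C = insert (a x0) (insert (b y0) (slack ` T))"
      define t where "t = Min C"
      have "finite T" unfolding T_def using fin by auto
      then have C: "finite C" "C \<noteq> {}" unfolding C_def by auto
      have t_le: "t \<le> c" if "c \<in> C" for c unfolding t_def using C that by simp
      have "0 \<le> c" if "c \<in> C" for c
        using that hall x0 y0 unfolding C_def T_def slack_def hall_def by auto
      then have t0: "0 \<le> t" unfolding t_def using C by simp
      define a' where "a' = a(x0 := a x0 - t)"
      define b' where "b' = b(y0 := b y0 - t)"
      have hall': "hall R X Y a' b'"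
        unfolding a'_def b'_def
      proof (rule hall_push[OF fin hall x0 y0])
        fix A assume "A \<subseteq> X - {x0}" "y0 \<in> R `` A"
        then have "slack A \<in> C" unfolding C_def T_def by auto
        then show "t \<le> sum b (Y \<inter> R `` A) - sum a A" using t_le unfolding slack_def by blast
      qed (use t_le C_def in auto)
      have "t \<in> C" unfolding t_def using C by simp
      then consider "t = a x0" | "t = b y0" | A where "A \<in> T" "t = slack A"
        unfolding C_def by auto
      then have "\<exists>g. transport R X Y a' b' g"
      proof cases
        case 1
        then show ?thesis using drop_source[OF hall'] unfolding a'_def by simp
      next
        case 2
        then have b0: "b' y0 = 0" unfolding b'_def by simp
        have "card (Y - {y0}) < card Y" using y0 fin by (intro psubset_card_mono) auto
        then obtain g where "transport R X (Y - {y0}) a' b' g"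
          using less.hyps[of X "Y - {y0}"] fin hall_diff_sink[OF fin(2) hall' b0] by auto
        then show ?thesis using transport_insert_sink[of Y R X y0 a' b' g] fin b0 by auto
      next
        case 3
        let ?B = "Y \<inter> R `` A"
        have A: "A \<subset> X" "A \<noteq> {}" "x0 \<notin> A" "y0 \<in> ?B" using 3 x0 y0 unfolding T_def by auto
        have "finite A" using A fin finite_subset by blast
        \<comment> \<open>Since \<open>x0\<close> is outside \<open>A\<close> but \<open>y0\<close>
          is a neighbour of it, only the capacity side drops. It drops by exactly the slack, so
          \<open>A\<close> becomes tight.\<close>
        have "sum a' A = sum a A" unfolding a'_def using A by (intro sum.cong) auto
        moreover have "sum b' ?B = sum b ?B - t"
          unfolding b'_def using A fin sum.remove[of ?B y0 b] sum.remove[of ?B y0 "b(y0 := b y0 - t)"]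
          by simp
        ultimately have tight: "sum a' A = sum b' ?B" using 3 unfolding slack_def by simp
        \<comment> \<open>\<open>?B\<close> may be all of \<open>Y\<close>; the strict decrease
          comes from the sources, as \<open>A\<close> is nonempty and misses
          \<open>x0\<close>.\<close>
        have cards: "card A < card X" "card ?B \<le> card Y" "card (X - A) < card X"
          "card (Y - ?B) \<le> card Y"
          using A fin by (auto intro!: psubset_card_mono card_mono)
        have "hall R A ?B a' b'"
          unfolding hall_def
        proof (intro conjI ballI allI impI)
          fix S assume S: "S \<subseteq> A"
          then have "?B \<inter> R `` S = Y \<inter> R `` S" by auto
          then show "sum a' S \<le> sum b' (?B \<inter> R `` S)" using hall' S A unfolding hall_def by auto
        qed (use hall' A in \<open>auto simp: hall_def\<close>)
        then obtain g where "transport R A ?B a' b' g"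
          using less.hyps[of A ?B] cards fin \<open>finite A\<close> by auto
        moreover have "hall R (X - A) (Y - ?B) a' b'"
          using hall_diff_tight[OF fin hall' _ tight] A by blast
        then obtain h where "transport R (X - A) (Y - ?B) a' b' h"
          using less.hyps[of "X - A" "Y - ?B"] cards fin by auto
        ultimately show ?thesis using transport_union[OF fin, of A ?B R a' b' g h] A by blast
      qed
      then show ?thesis using transport_push[OF fin x0 y0 t0] unfolding a'_def b'_def by blast
    qed
  qed
qed

section \<open>Strassen's theorem\<close>

text \<open>The row sums already force total mass 1, so \<open>embed_pmf\<close> turns the weights
  into a distribution.\<close>

lemma coupling_from_weights:
  fixes \<mu> \<nu> :: "'a pmf" and w :: "'a \<times> 'a \<Rightarrow> real"
  assumes fin: "finite X" "finite Y" and supp: "set_pmf \<mu> \<subseteq> X" "set_pmf \<nu> \<subseteq> Y"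
    and nonneg: "\<And>z. 0 \<le> w z" and zero: "\<And>z. z \<notin> X \<times> Y \<Longrightarrow> w z = 0"
    and row: "\<And>x. x \<in> X \<Longrightarrow> (\<Sum>y\<in>Y. w (x, y)) = pmf \<mu> x"
    and col: "\<And>y. y \<in> Y \<Longrightarrow> (\<Sum>x\<in>X. w (x, y)) = pmf \<nu> y"
  obtains \<rho> where "\<rho> \<in> couplings \<mu> \<nu>" "pmf \<rho> = w"
proof -
  have "(\<Sum>z\<in>X \<times> Y. w z) = (\<Sum>x\<in>X. \<Sum>y\<in>Y. w (x, y))"
    by (simp add: sum.cartesian_product)
  also have "\<dots> = (\<Sum>x\<in>X. pmf \<mu> x)" using row by simp
  also have "\<dots> = 1" using sum_pmf_eq_1 fin supp by blast
  finally have total: "(\<Sum>z\<in>X \<times> Y. w z) = 1" .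
  have "(\<integral>\<^sup>+ z. ennreal (w z) \<partial>count_space UNIV) = (\<Sum>z\<in>X \<times> Y. ennreal (w z))"
    using fin zero by (intro nn_integral_count_space') auto
  also have "\<dots> = 1" using total nonneg by (simp add: sum_ennreal)
  finally have int: "(\<integral>\<^sup>+ z. ennreal (w z) \<partial>count_space UNIV) = 1" .
  define \<rho> where "\<rho> = embed_pmf w"
  have w: "pmf \<rho> z = w z" for z unfolding \<rho>_def using nonneg int by (rule pmf_embed_pmf)
  have set: "set_pmf \<rho> \<subseteq> X \<times> Y" using zero w by (metis set_pmf_iff subsetI)
  have prob: "measure_pmf.prob \<rho> S = sum w (S \<inter> X \<times> Y)" for S
  proof -
    have "measure_pmf.prob \<rho> S = measure_pmf.prob \<rho> (S \<inter> X \<times> Y)"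
      by (rule measure_pmf.finite_measure_eq_AE) (use set in \<open>auto simp: AE_measure_pmf_iff\<close>)
    also have "\<dots> = sum w (S \<inter> X \<times> Y)"
      using fin w by (subst measure_measure_pmf_finite) auto
    finally show ?thesis .
  qed
  have "pmf (map_pmf fst \<rho>) x = pmf \<mu> x" for x
  proof (cases "x \<in> X")
    case True
    then have "fst -` {x} \<inter> X \<times> Y = Pair x ` Y" by auto
    then have "pmf (map_pmf fst \<rho>) x = (\<Sum>y\<in>Y. w (x, y))"
      by (simp add: pmf_map prob sum.reindex inj_on_def)
    then show ?thesis using row True by simp
  next
    case False
    then have "fst -` {x} \<inter> X \<times> Y = {}" by auto
    then show ?thesis using False supp by (auto simp: pmf_map prob pmf_eq_0_set_pmf)
  qed
  moreover have "pmf (map_pmf snd \<rho>) y = pmf \<nu> y" for y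
  proof (cases "y \<in> Y")
    case True
    then have "snd -` {y} \<inter> X \<times> Y = (\<lambda>x. (x, y)) ` X" by auto
    then have "pmf (map_pmf snd \<rho>) y = (\<Sum>x\<in>X. w (x, y))"
      by (simp add: pmf_map prob sum.reindex inj_on_def)
    then show ?thesis using col True by simp
  next
    case False
    then have "snd -` {y} \<inter> X \<times> Y = {}" by auto
    then show ?thesis using False supp by (auto simp: pmf_map prob pmf_eq_0_set_pmf)
  qed
  moreover have "finite (set_pmf \<rho>)" using set fin finite_subset by blast
  ultimately have "\<rho> \<in> couplings \<mu> \<nu>"
    unfolding couplings_def fin_dists_def by (auto intro: pmf_eqI)
  then show thesis using that w by blast
qed

text \<open>Hall's theorem moves all but mass at most \<open>\<epsilon>\<close> along
  \<open>R\<close>. The leftovers of the two marginals have equal mass and are coupled by a product,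
  whose whole mass may fall outside \<open>R\<close>.\<close>

theorem strassen:
  fixes \<mu> \<nu> :: "'a pmf"
  assumes fin: "finite (set_pmf \<mu>)" "finite (set_pmf \<nu>)" and e: "0 \<le> \<epsilon>"
    and le: "\<And>A. A \<subseteq> set_pmf \<mu> \<Longrightarrow>
      measure_pmf.prob \<mu> A \<le> measure_pmf.prob \<nu> (R `` A) + \<epsilon>"
  shows "\<exists>\<rho>\<in>couplings \<mu> \<nu>. measure_pmf.prob \<rho> (- R) \<le> \<epsilon>"
proof -
  define X Y where "X = set_pmf \<mu>" and "Y = set_pmf \<nu>"
  note finXY = fin[folded X_def Y_def]
  \<comment> \<open>A dummy sink \<open>None\<close> of capacity \<open>\<epsilon>\<close>, reachable from everywhere, absorbs the deficiency.\<close>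
  define R' where "R' = {(x, z). case z of None \<Rightarrow> True | Some y \<Rightarrow> (x, y) \<in> R}"
  define b where "b z = (case z of None \<Rightarrow> \<epsilon> | Some y \<Rightarrow> pmf \<nu> y)" for z
  define Y' where "Y' = insert None (Some ` Y)"
  have finY': "finite Y'" unfolding Y'_def using finXY by simp
  have sumY': "sum f Y' = f None + (\<Sum>y\<in>Y. f (Some y))" for f :: "'a option \<Rightarrow> real"
    unfolding Y'_def using finXY by (subst sum.insert) (auto simp: sum.reindex)
  have "hall R' X Y' (pmf \<mu>) b"
    unfolding hall_def
  proof (intro conjI ballI allI impI)
    fix A assume A: "A \<subseteq> X"
    show "sum (pmf \<mu>) A \<le> sum b (Y' \<inter> R' `` A)"
    proof (cases "A = {}")
      case False
      have "sum (pmf \<mu>) A = measure_pmf.prob \<mu> A"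
        using A finXY finite_subset by (subst measure_measure_pmf_finite) auto
      also have "\<dots> \<le> measure_pmf.prob \<nu> (R `` A) + \<epsilon>" using le A unfolding X_def by blast
      also have "measure_pmf.prob \<nu> (R `` A) = measure_pmf.prob \<nu> (R `` A \<inter> Y)"
        unfolding Y_def by (simp add: measure_Int_set_pmf)
      also have "\<dots> = sum (pmf \<nu>) (R `` A \<inter> Y)"
        using finXY by (subst measure_measure_pmf_finite) auto
      also have "\<dots> + \<epsilon> = sum b (insert None (Some ` (R `` A \<inter> Y)))"
        using finXY by (subst sum.insert) (auto simp: sum.reindex b_def)
      also have "insert None (Some ` (R `` A \<inter> Y)) = Y' \<inter> R' `` A"
        using False unfolding Y'_def R'_def by (auto split: option.splits)
      finally show ?thesis .
    qed simp
  qed (auto simp: b_def e split: option.splits)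
  then obtain g where g: "transport R' X Y' (pmf \<mu>) b g"
    using fractional_hall finXY finY' by blast
  define h r s where "h x y = g x (Some y)" and "r x = g x None"
    and "s y = (if y \<in> Y then pmf \<nu> y - (\<Sum>x\<in>X. g x (Some y)) else 0)" for x y
  define m where "m = sum r X"
  have h: "0 \<le> h x y" "h x y \<noteq> 0 \<Longrightarrow> x \<in> X \<and> y \<in> Y \<and> (x, y) \<in> R" for x y
    using g unfolding transport_def h_def Y'_def R'_def by fastforce+
  have r: "0 \<le> r x" "x \<notin> X \<Longrightarrow> r x = 0" for x
    using g unfolding transport_def r_def by auto
  have s: "0 \<le> s y" for y
    using g unfolding transport_def s_def Y'_def b_def by auto
  have row: "r x + (\<Sum>y\<in>Y. h x y) = pmf \<mu> x" if "x \<in> X" for x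
    using g that unfolding transport_def sumY' r_def h_def by blast
  have m: "m \<le> \<epsilon>" using g unfolding transport_def m_def r_def Y'_def b_def by fastforce
  have "sum s Y = sum (pmf \<nu>) Y - (\<Sum>y\<in>Y. \<Sum>x\<in>X. h x y)"
    by (simp add: s_def h_def sum_subtractf)
  also have "sum (pmf \<nu>) Y = sum (pmf \<mu>) X"
    using finXY sum_pmf_eq_1 unfolding X_def Y_def by (metis subset_refl)
  also have "(\<Sum>y\<in>Y. \<Sum>x\<in>X. h x y) = (\<Sum>x\<in>X. \<Sum>y\<in>Y. h x y)" by (rule sum.swap)
  also have "sum (pmf \<mu>) X = sum r X + (\<Sum>x\<in>X. \<Sum>y\<in>Y. h x y)"
    using row by (simp add: sum.distrib[symmetric])
  finally have sm: "sum s Y = m" unfolding m_def by simp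
  have m0: "0 \<le> m" unfolding m_def using r by (simp add: sum_nonneg)
  \<comment> \<open>The residual masses are coupled independently. If \<open>m = 0\<close>, then \<open>r = s = 0\<close> and the junk value
    \<open>r x * s y / 0 = 0\<close> is the right one.\<close>
  define w where "w z = h (fst z) (snd z) + r (fst z) * s (snd z) / m" for z
  have "r x * m / m = r x" if "x \<in> X" for x
    using r finXY that sum_nonneg_eq_0_iff[of X r] unfolding m_def by (cases "sum r X = 0") auto
  then have roww: "(\<Sum>y\<in>Y. w (x, y)) = pmf \<mu> x" if "x \<in> X" for x
    using row[OF that] that
    by (simp add: w_def sum.distrib sum_divide_distrib[symmetric] sum_distrib_left[symmetric] sm)
  have "m * s y / m = s y" if "y \<in> Y" for y
    using s finXY that sum_nonneg_eq_0_iff[of Y s] unfolding sm[symmetric]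
    by (cases "sum s Y = 0") auto
  then have colw: "(\<Sum>x\<in>X. w (x, y)) = pmf \<nu> y" if "y \<in> Y" for y
    using that
    by (simp add: w_def sum.distrib sum_divide_distrib[symmetric] sum_distrib_right[symmetric]
      m_def[symmetric]) (simp add: s_def h_def)
  have w0: "w z = 0" if "z \<notin> X \<times> Y" for z
  proof -
    have "h (fst z) (snd z) = 0" using that h(2) by (metis mem_Times_iff)
    then show ?thesis using that r(2) by (cases z) (auto simp: w_def s_def)
  qed
  have wn: "0 \<le> w z" for z unfolding w_def using h r s m0 by simp
  obtain \<rho> where \<rho>: "\<rho> \<in> couplings \<mu> \<nu>" "pmf \<rho> = w"
    using coupling_from_weights[OF finXY _ _ wn w0 roww colw] unfolding X_def Y_def by blast
  have "set_pmf \<rho> \<subseteq> X \<times> Y" using w0 \<rho>(2) by (metis set_pmf_iff subsetI)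
  then have "measure_pmf.prob \<rho> (- R) = measure_pmf.prob \<rho> (- R \<inter> X \<times> Y)"
    by (intro measure_pmf.finite_measure_eq_AE) (auto simp: AE_measure_pmf_iff)
  also have "\<dots> = sum w (- R \<inter> X \<times> Y)"
    using finXY \<rho>(2) by (subst measure_measure_pmf_finite) auto
  \<comment> \<open>Off \<open>R\<close> only the product term survives. Its total mass is
    \<open>m * m / m\<close>, which equals \<open>m\<close> even when \<open>m\<close> is 0.\<close>
  also have "\<dots> = (\<Sum>z\<in>- R \<inter> X \<times> Y. r (fst z) * s (snd z) / m)"
    using h(2) by (intro sum.cong) (auto simp: w_def, metis)
  also have "\<dots> \<le> (\<Sum>z\<in>X \<times> Y. r (fst z) * s (snd z) / m)"
    using finXY r s m0 by (intro sum_mono2) auto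
  also have "\<dots> = (\<Sum>x\<in>X. \<Sum>y\<in>Y. r x * s y / m)"
    by (simp add: sum.cartesian_product case_prod_unfold)
  also have "\<dots> = m * m / m"
    by (simp add: sum_divide_distrib[symmetric] sum_product[symmetric] sm m_def[symmetric])
  also have "\<dots> \<le> \<epsilon>" using m e by simp
  finally show ?thesis using \<rho> by blast
qed

section \<open>Comparing the liftings\<close>

lemma bdd_below_prob_lifting_set:
  "bdd_below {\<epsilon>. 0 \<le> \<epsilon> \<and> measure_pmf.prob \<mu> {z. f z > \<epsilon>} \<le> \<epsilon>}"
  by (rule bdd_belowI[of _ 0]) auto

lemma prob_lifting_le:
  "0 \<le> \<epsilon> \<Longrightarrow> measure_pmf.prob \<mu> {z. f z > \<epsilon>} \<le> \<epsilon> \<Longrightarrow> prob_lifting f \<mu> \<le> \<epsilon>"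
  unfolding prob_lifting_def by (rule cInf_lower[OF _ bdd_below_prob_lifting_set]) simp

text \<open>The candidate 1 is always admissible, so the infimum is never over the empty
  set.\<close>

lemma prob_lifting_ge:
  assumes "\<And>\<epsilon>. 0 \<le> \<epsilon> \<Longrightarrow> measure_pmf.prob \<mu> {z. f z > \<epsilon>} \<le> \<epsilon> \<Longrightarrow> c \<le> \<epsilon>"
  shows "c \<le> prob_lifting f \<mu>"
proof -
  have "1 \<in> {\<epsilon>. 0 \<le> \<epsilon> \<and> measure_pmf.prob \<mu> {z. f z > \<epsilon>} \<le> \<epsilon>}" by simp
  then show ?thesis unfolding prob_lifting_def using assms by (intro cInf_greatest) blast+
qed

lemma prob_lifting_nonneg: "0 \<le> prob_lifting f \<mu>"
  by (rule prob_lifting_ge)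

lemma prob_lifting_le_one: "prob_lifting f \<mu> \<le> 1"
  by (rule prob_lifting_le) auto

text \<open>A union bound: \<open>v (q z)\<close> exceeds \<delta> + \<epsilon> only if
  \<open>u (p z)\<close> exceeds \<delta> or \<open>c z\<close> exceeds \<epsilon>. For a coupling,
  \<open>p\<close> and \<open>q\<close> are the projections and \<open>c\<close> is the
  distance.\<close>

lemma prob_lifting_map_le:
  assumes le: "\<And>z. v (q z) \<le> u (p z) + c z"
  shows "prob_lifting v (map_pmf q \<rho>) \<le> prob_lifting u (map_pmf p \<rho>) + prob_lifting c \<rho>"
proof -
  \<comment> \<open>The difference form allows \<open>prob_lifting_ge\<close> to be applied first
    over \<epsilon> and then over \<delta>.\<close>
  have "prob_lifting v (map_pmf q \<rho>) - \<delta> \<le> \<epsilon>"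
    if \<delta>: "0 \<le> \<delta>" "measure_pmf.prob (map_pmf p \<rho>) {x. u x > \<delta>} \<le> \<delta>"
      and \<epsilon>: "0 \<le> \<epsilon>" "measure_pmf.prob \<rho> {z. c z > \<epsilon>} \<le> \<epsilon>" for \<delta> \<epsilon>
  proof -
    have "measure_pmf.prob (map_pmf q \<rho>) {y. v y > \<delta> + \<epsilon>} = measure_pmf.prob \<rho> {z. v (q z) > \<delta> + \<epsilon>}"
      by (simp add: vimage_def)
    also have "\<dots> \<le> measure_pmf.prob \<rho> ({z. u (p z) > \<delta>} \<union> {z. c z > \<epsilon>})"
    proof (rule measure_pmf.finite_measure_mono)
      show "{z. v (q z) > \<delta> + \<epsilon>} \<subseteq> {z. u (p z) > \<delta>} \<union> {z. c z > \<epsilon>}"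
      proof
        fix z assume "z \<in> {z. v (q z) > \<delta> + \<epsilon>}"
        then show "z \<in> {z. u (p z) > \<delta>} \<union> {z. c z > \<epsilon>}" using le[of z] by auto
      qed
    qed simp
    also have "\<dots> \<le> measure_pmf.prob \<rho> {z. u (p z) > \<delta>} + measure_pmf.prob \<rho> {z. c z > \<epsilon>}"
      by (rule measure_Un_le) auto
    also have "\<dots> \<le> \<delta> + \<epsilon>" using \<delta> \<epsilon> by (simp add: vimage_def)
    finally have "prob_lifting v (map_pmf q \<rho>) \<le> \<delta> + \<epsilon>"
      using \<delta>(1) \<epsilon>(1) by (intro prob_lifting_le add_nonneg_nonneg)
    then show ?thesis by simp
  qed
  then have "prob_lifting v (map_pmf q \<rho>) - \<delta> \<le> prob_lifting c \<rho>"
    if "0 \<le> \<delta>" "measure_pmf.prob (map_pmf p \<rho>) {x. u x > \<delta>} \<le> \<delta>" for \<delta>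
    using that by (blast intro: prob_lifting_ge)
  then have "prob_lifting v (map_pmf q \<rho>) - prob_lifting c \<rho> \<le> prob_lifting u (map_pmf p \<rho>)"
    by (intro prob_lifting_ge) (simp add: algebra_simps)
  then show ?thesis by simp
qed

section \<open>Kantorovich against Wasserstein\<close>

lemma nonexpansive_coupling_le:
  assumes "nonexpansive d f" "\<rho> \<in> couplings \<mu> \<nu>"
  shows "\<bar>prob_lifting f \<nu> - prob_lifting f \<mu>\<bar> \<le> prob_lifting (case_prod d) \<rho>"
proof -
  have \<rho>: "map_pmf fst \<rho> = \<mu>" "map_pmf snd \<rho> = \<nu>" using assms(2) unfolding couplings_def by auto
  have f: "\<bar>f (fst z) - f (snd z)\<bar> \<le> case_prod d z" for z
    using assms(1) unfolding nonexpansive_def by (simp add: case_prod_unfold)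
  have "prob_lifting f \<nu> \<le> prob_lifting f \<mu> + prob_lifting (case_prod d) \<rho>"
    unfolding \<rho>[symmetric]
  proof (rule prob_lifting_map_le)
    show "f (snd z) \<le> f (fst z) + case_prod d z" for z using f[of z] by simp
  qed
  moreover have "prob_lifting f \<mu> \<le> prob_lifting f \<nu> + prob_lifting (case_prod d) \<rho>"
    unfolding \<rho>[symmetric]
  proof (rule prob_lifting_map_le)
    show "f (fst z) \<le> f (snd z) + case_prod d z" for z using f[of z] by simp
  qed
  ultimately show ?thesis by simp
qed

text \<open>Liftings take values between 0 and 1, so the differences are bounded by 1 and the real
  supremum is a genuine upper bound.\<close>

lemma kantorovich_upper:
  assumes "nonexpansive d f"
  shows "\<bar>prob_lifting f \<nu> - prob_lifting f \<mu>\<bar> \<le> kantorovich prob_lifting d \<mu> \<nu>"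
  unfolding kantorovich_def
proof (rule cSup_upper)
  have "\<bar>prob_lifting f \<nu> - prob_lifting f \<mu>\<bar> \<le> 1" for f
    using prob_lifting_nonneg[of f \<mu>] prob_lifting_nonneg[of f \<nu>]
      prob_lifting_le_one[of f \<mu>] prob_lifting_le_one[of f \<nu>] by linarith
  then show "bdd_above {\<bar>prob_lifting f \<nu> - prob_lifting f \<mu>\<bar> |f. nonexpansive d f}"
    by (intro bdd_aboveI[of _ 1]) auto
qed (use assms in blast)

lemma nonexpansive_const:
  assumes "bounded_pseudometric d" "c \<in> {0..1}"
  shows "nonexpansive d (\<lambda>_. c)"
  using assms unfolding nonexpansive_def bounded_pseudometric_def by auto

lemma kantorovich_nonneg:
  assumes "bounded_pseudometric d"
  shows "0 \<le> kantorovich prob_lifting d \<mu> \<nu>"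
  using kantorovich_upper[OF nonexpansive_const[OF assms, of 0], of \<nu> \<mu>] by force

lemma kantorovich_le_wasserstein:
  assumes d: "bounded_pseudometric d" and fin: "\<mu> \<in> fin_dists" "\<nu> \<in> fin_dists"
  shows "kantorovich prob_lifting d \<mu> \<nu> \<le> wasserstein prob_lifting d \<mu> \<nu>"
  unfolding kantorovich_def
proof (rule cSup_least)
  show "{\<bar>prob_lifting f \<nu> - prob_lifting f \<mu>\<bar> |f. nonexpansive d f} \<noteq> {}"
    using nonexpansive_const[OF d, of 0] by auto
next
  fix c assume "c \<in> {\<bar>prob_lifting f \<nu> - prob_lifting f \<mu>\<bar> |f. nonexpansive d f}"
  then obtain f where f: "nonexpansive d f" "c = \<bar>prob_lifting f \<nu> - prob_lifting f \<mu>\<bar>" by blast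
  \<comment> \<open>The product coupling shows that the Wasserstein infimum ranges over a nonempty
    set.\<close>
  have "pair_pmf \<mu> \<nu> \<in> couplings \<mu> \<nu>"
    using fin unfolding couplings_def fin_dists_def by (simp add: map_fst_pair_pmf map_snd_pair_pmf)
  then show "c \<le> wasserstein prob_lifting d \<mu> \<nu>"
    unfolding wasserstein_def f(2) using nonexpansive_coupling_le[OF f(1)]
    by (intro cINF_greatest) auto
qed

section \<open>The distance to a set\<close>

lemma bdd_below_dist:
  assumes "bounded_pseudometric d"
  shows "bdd_below (insert 1 ((\<lambda>x. d x y) ` A))"
  using assms by (intro bdd_belowI[of _ 0]) (auto simp: bounded_pseudometric_def)

lemma set_dist_range:
  assumes "bounded_pseudometric d"
  shows "set_dist d A y \<in> {0..1}"
proof -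
  have "0 \<le> set_dist d A y" unfolding set_dist_def
    using assms by (intro cInf_greatest) (auto simp: bounded_pseudometric_def)
  moreover have "set_dist d A y \<le> 1" unfolding set_dist_def
    using bdd_below_dist[OF assms] by (intro cInf_lower) auto
  ultimately show ?thesis by simp
qed

lemma set_dist_eq_0:
  assumes "bounded_pseudometric d" "y \<in> A"
  shows "set_dist d A y = 0"
proof -
  have "set_dist d A y \<le> d y y" unfolding set_dist_def
    using bdd_below_dist[OF assms(1)] assms(2) by (intro cInf_lower) auto
  then show ?thesis using assms(1) set_dist_range[OF assms(1), of A y]
    by (simp add: bounded_pseudometric_def)
qed

text \<open>Take the infimum over \<open>x\<close> in the triangle inequality. The inserted value 1
  needs its own case, settled by the upper bound 1 on \<open>set_dist\<close>.\<close>

lemma set_dist_triangle: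
  assumes d: "bounded_pseudometric d"
  shows "set_dist d A y \<le> set_dist d A z + d z y"
proof -
  have "set_dist d A y - d z y \<le> set_dist d A z"
    unfolding set_dist_def[of d A z]
  proof (rule cInf_greatest)
    fix c assume "c \<in> insert 1 ((\<lambda>x. d x z) ` A)"
    then consider "c = 1" | x where "x \<in> A" "c = d x z" by auto
    then show "set_dist d A y - d z y \<le> c"
    proof cases
      case 1
      have "0 \<le> d z y" using d by (simp add: bounded_pseudometric_def)
      then show ?thesis using 1 set_dist_range[OF d, of A y] by simp
    next
      case 2
      have "set_dist d A y \<le> d x y" unfolding set_dist_def
        using bdd_below_dist[OF d] 2 by (intro cInf_lower) auto
      also have "\<dots> \<le> d x z + d z y" using d unfolding bounded_pseudometric_def by blast
      finally show ?thesis using 2 by simp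
    qed
  qed simp
  then show ?thesis by simp
qed

lemma nonexpansive_set_dist:
  assumes d: "bounded_pseudometric d" and s: "s \<le> 1"
  shows "nonexpansive d (\<lambda>y. max 0 (s - set_dist d A y))"
  unfolding nonexpansive_def
proof (intro conjI allI)
  fix x y
  show "max 0 (s - set_dist d A x) \<in> {0..1}" using s set_dist_range[OF d, of A x] by auto
  have "d x y = d y x" using d unfolding bounded_pseudometric_def by blast
  then show "\<bar>max 0 (s - set_dist d A x) - max 0 (s - set_dist d A y)\<bar> \<le> d x y"
    using set_dist_triangle[OF d, of A x y] set_dist_triangle[OF d, of A y x] by linarith
qed

section \<open>Levy-Prokhorov against the other two distances\<close>

lemma bdd_below_levy_prokhorov_set:
  "bdd_below {\<epsilon>. \<forall>A. measure_pmf.prob \<mu> A \<le> measure_pmf.prob \<nu> (fattening d \<epsilon> A) + \<epsilon>}"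
proof (rule bdd_belowI)
  fix \<epsilon> assume "\<epsilon> \<in> {\<epsilon>. \<forall>A. measure_pmf.prob \<mu> A \<le> measure_pmf.prob \<nu> (fattening d \<epsilon> A) + \<epsilon>}"
  then have "measure_pmf.prob \<mu> {} \<le> measure_pmf.prob \<nu> (fattening d \<epsilon> {}) + \<epsilon>" by blast
  also have "\<dots> \<le> 1 + \<epsilon>" by simp
  finally show "- 1 \<le> \<epsilon>" by simp
qed

text \<open>It suffices that every \<epsilon> strictly above the Kantorovich distance is admissible
  in the Levy-Prokhorov infimum.\<close>

lemma levy_prokhorov_le_kantorovich:
  assumes d: "bounded_pseudometric d"
  shows "levy_prokhorov d \<mu> \<nu> \<le> kantorovich prob_lifting d \<mu> \<nu>"
proof (rule dense_ge)
  fix \<epsilon> assume \<epsilon>: "kantorovich prob_lifting d \<mu> \<nu> < \<epsilon>"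
  then have \<epsilon>0: "0 < \<epsilon>" using kantorovich_nonneg[OF d, of \<mu> \<nu>] by linarith
  have "measure_pmf.prob \<mu> A \<le> measure_pmf.prob \<nu> (fattening d \<epsilon> A) + \<epsilon>" for A
  proof (rule ccontr)
    \<comment> \<open>\<open>f\<close> equals \<open>s\<close> on \<open>A\<close>, so its lifting
      at \<mu> is at least \<open>s\<close>. It exceeds \<open>s - \<epsilon>\<close> only inside
      the fattening, whose \<nu>-mass is below \<open>s - \<epsilon>\<close>, so its lifting at
      \<nu> is at most that. The gap of \<epsilon> is the contradiction.\<close>
    define s where "s = measure_pmf.prob \<mu> A"
    define f where "f y = max 0 (s - set_dist d A y)" for y
    assume "\<not> ?thesis"
    then have s: "measure_pmf.prob \<nu> (fattening d \<epsilon> A) + \<epsilon> < s" unfolding s_def by simp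
    then have s\<epsilon>: "\<epsilon> < s" using measure_nonneg[of "measure_pmf \<nu>" "fattening d \<epsilon> A"] by linarith
    have "s \<le> 1" unfolding s_def by simp
    then have f: "nonexpansive d f" unfolding f_def by (rule nonexpansive_set_dist[OF d])
    have "s \<le> prob_lifting f \<mu>"
    proof (rule prob_lifting_ge, rule ccontr)
      fix \<delta> assume \<delta>: "0 \<le> \<delta>" "measure_pmf.prob \<mu> {z. f z > \<delta>} \<le> \<delta>" "\<not> s \<le> \<delta>"
      have "A \<subseteq> {z. f z > \<delta>}" using \<delta>(3) set_dist_eq_0[OF d] unfolding f_def by auto
      then have "s \<le> measure_pmf.prob \<mu> {z. f z > \<delta>}"
        unfolding s_def by (intro measure_pmf.finite_measure_mono) auto
      then show False using \<delta> by simp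
    qed
    moreover have "prob_lifting f \<nu> \<le> s - \<epsilon>"
    proof (rule prob_lifting_le)
      have "{z. f z > s - \<epsilon>} \<subseteq> fattening d \<epsilon> A"
        using s\<epsilon> unfolding f_def fattening_def by auto
      then have "measure_pmf.prob \<nu> {z. f z > s - \<epsilon>} \<le> measure_pmf.prob \<nu> (fattening d \<epsilon> A)"
        by (intro measure_pmf.finite_measure_mono) auto
      then show "measure_pmf.prob \<nu> {z. f z > s - \<epsilon>} \<le> s - \<epsilon>" using s by simp
    qed (use s\<epsilon> in simp)
    ultimately show False using kantorovich_upper[OF f, of \<nu> \<mu>] \<epsilon> by linarith
  qed
  then show "levy_prokhorov d \<mu> \<nu> \<le> \<epsilon>"
    unfolding levy_prokhorov_def by (intro cInf_lower bdd_below_levy_prokhorov_set) auto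
qed

text \<open>The infimum over a finite set is attained, and \<epsilon> < 1 rules out the inserted
  value 1. This links the fattening to the relation used in \<open>strassen\<close>.\<close>

lemma fattening_finite:
  assumes "finite A" "\<epsilon> < 1" "y \<in> fattening d \<epsilon> A"
  shows "\<exists>x\<in>A. d x y \<le> \<epsilon>"
proof -
  have "set_dist d A y \<in> insert 1 ((\<lambda>x. d x y) ` A)"
    unfolding set_dist_def using assms(1) Min_in[of "insert 1 ((\<lambda>x. d x y) ` A)"]
    by (subst cInf_eq_Min) auto
  then show ?thesis using assms(2,3) unfolding fattening_def by auto
qed

text \<open>Each admissible \<epsilon> gives the hypothesis of \<open>strassen\<close> for the
  relation \<open>d x y \<le> \<epsilon>\<close>; the resulting coupling has lifting at most
  \<epsilon>.\<close>

lemma wasserstein_le_levy_prokhorov: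
  assumes fin: "\<mu> \<in> fin_dists" "\<nu> \<in> fin_dists"
  shows "wasserstein prob_lifting d \<mu> \<nu> \<le> levy_prokhorov d \<mu> \<nu>"
  unfolding levy_prokhorov_def
proof (rule cInf_greatest)
  have "measure_pmf.prob \<mu> A \<le> measure_pmf.prob \<nu> (fattening d 1 A) + 1" for A
    using measure_pmf.prob_le_1[of \<mu> A] measure_nonneg[of "measure_pmf \<nu>" "fattening d 1 A"]
    by linarith
  then show "{\<epsilon>. \<forall>A. measure_pmf.prob \<mu> A \<le> measure_pmf.prob \<nu> (fattening d \<epsilon> A) + \<epsilon>} \<noteq> {}"
    by blast
next
  fix \<epsilon> assume "\<epsilon> \<in> {\<epsilon>. \<forall>A. measure_pmf.prob \<mu> A \<le> measure_pmf.prob \<nu> (fattening d \<epsilon> A) + \<epsilon>}"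
  then have le: "measure_pmf.prob \<mu> A \<le> measure_pmf.prob \<nu> (fattening d \<epsilon> A) + \<epsilon>" for A by blast
  \<comment> \<open>The empty set is at distance 1 from every point, so a negative \<epsilon> would
    give it an empty fattening.\<close>
  have \<epsilon>: "0 \<le> \<epsilon>"
  proof (rule ccontr)
    assume "\<not> 0 \<le> \<epsilon>"
    then have "fattening d \<epsilon> {} = {}" unfolding fattening_def set_dist_empty by auto
    then show False using le[of "{}"] \<open>\<not> 0 \<le> \<epsilon>\<close> by simp
  qed
  let ?R = "{(x, y). d x y \<le> \<epsilon>}"
  have "measure_pmf.prob \<mu> A \<le> measure_pmf.prob \<nu> (?R `` A) + \<epsilon>" if A: "A \<subseteq> set_pmf \<mu>" for A
  \<comment> \<open>For \<epsilon> at least 1 the fattening is everything, even for empty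
    \<open>A\<close>, but the required bound is then trivial.\<close>
  proof (cases "\<epsilon> < 1")
    case True
    have "finite A" using A fin finite_subset unfolding fin_dists_def by blast
    then have "fattening d \<epsilon> A \<subseteq> ?R `` A" using fattening_finite[OF _ True] by fastforce
    then have "measure_pmf.prob \<nu> (fattening d \<epsilon> A) \<le> measure_pmf.prob \<nu> (?R `` A)"
      by (intro measure_pmf.finite_measure_mono) auto
    then show ?thesis using le[of A] by simp
  next
    case False
    then show ?thesis
      using measure_pmf.prob_le_1[of \<mu> A] measure_nonneg[of "measure_pmf \<nu>" "?R `` A"] by linarith
  qed
  then obtain \<rho> where \<rho>: "\<rho> \<in> couplings \<mu> \<nu>" "measure_pmf.prob \<rho> (- ?R) \<le> \<epsilon>"
    using strassen[of \<mu> \<nu> \<epsilon> ?R] fin \<epsilon> unfolding fin_dists_def by auto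
  have "- ?R = {z. case_prod d z > \<epsilon>}" by auto
  then have "prob_lifting (case_prod d) \<rho> \<le> \<epsilon>" using \<rho>(2) \<epsilon> by (intro prob_lifting_le) auto
  moreover have "wasserstein prob_lifting d \<mu> \<nu> \<le> prob_lifting (case_prod d) \<rho>"
    unfolding wasserstein_def
    by (intro cINF_lower[OF _ \<rho>(1)] bdd_belowI2[of _ 0] prob_lifting_nonneg)
  ultimately show "wasserstein prob_lifting d \<mu> \<nu> \<le> \<epsilon>" by simp
qed

theorem theorem2:
  fixes d :: "'a \<Rightarrow> 'a \<Rightarrow> real" and \<mu> \<nu> :: "'a pmf"
  assumes "bounded_pseudometric d"
    and "\<mu> \<in> fin_dists" and "\<nu> \<in> fin_dists"
  shows "levy_prokhorov d \<mu> \<nu> = kantorovich prob_lifting d \<mu> \<nu> \<and>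
         kantorovich prob_lifting d \<mu> \<nu> = wasserstein prob_lifting d \<mu> \<nu>"
  using levy_prokhorov_le_kantorovich[OF assms(1), of \<mu> \<nu>] kantorovich_le_wasserstein[OF assms]
    wasserstein_le_levy_prokhorov[OF assms(2,3), of d] by linarith

end
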